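(* Let $\Sigma$ be a finite alphabet, let $L\subseteq\Sigma^{*}$, and let $\Theta := (\Theta(\Sigma^{(n)},L) \mid n\in\mathbb{N})$. Then $$\dim(\Sigma^{*}, d_\Theta) = h(L).$$
   Context: $\Sigma^{*}$ is the free monoid of words over $\Sigma$, and $\Sigma^{(n)}$ is the set of words of length at most $n$. For finite $F\subseteq\Sigma^{*}$, $\Theta(F,L)$ is the equivalence relation on $\Sigma^{*}$ with $(u,v)\in\Theta(F,L)$ iff for all $w\in F$: $uw\in L\Leftrightarrow vw\in L$. Let $\gamma_L(F)$ be the (finite) number of its equivalence classes, and let $h(L) := \limsup_{n\to\infty}\frac{1}{n}\log_2\gamma_L(\Sigma^{(n)})$. For a non-empty set $X$ and a descending sequence $\Theta=(\Theta_n\mid n\in\mathbb{N})$ of equivalence relations on $X$ (i.e. $\Theta_{n+1}\subseteq\Theta_n$), define the pseudo-ultrametric $d_\Theta(x,y) := 2^{-\inf\{n\in\mathbb{N}\mid (x,y)\notin\Theta_n\}}$, with $\inf\emptyset=\infty$ and $2^{-\infty}=0$. A pseudo-metric space $(X,d)$ is precompact if for each $r\in(0,\infty)$ the space $X$ is a union of finitely many open balls $B_d(x,r)=\{y\in X\mid d(x,y)<r\}$ with centres in $X$; then $\gamma_{(X,d)}(r)$ denotes the minimal number of such balls needed to cover $X$. The entropic dimension of a precompact pseudo-metric space is $\dim(X,d) := \limsup_{r\to 0+}\frac{\log_2\gamma_{(X,d)}(r)}{\log_2(1/r)}$. (The space $(\Sigma^{*},d_\Theta)$ in the claim is precompact.)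 *)

theory Defs
  imports Complex_Main "HOL-Library.Extended_Nat" "HOL-Library.Extended_Real"
begin

section \<open>Topological entropy of a language\<close>

definition words_upto :: "'a set \<Rightarrow> nat \<Rightarrow> 'a list set" where
  "words_upto A n = {w \<in> lists A. length w \<le> n}"

definition lang_rel :: "'a set \<Rightarrow> 'a list set \<Rightarrow> 'a list set \<Rightarrow> ('a list \<times> 'a list) set" where
  "lang_rel A F L = {(u, v). u \<in> lists A \<and> v \<in> lists A \<and> (\<forall>w\<in>F. u @ w \<in> L \<longleftrightarrow> v @ w \<in> L)}"

definition class_count :: "'a set \<Rightarrow> 'a list set \<Rightarrow> 'a list set \<Rightarrow> nat" where
  "class_count A L F = card (lists A // lang_rel A F L)"

text \<open>The entropy may be infinite, hence the extended real value.  The summand at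
  \<open>n = 0\<close> is \<open>0\<close> by the convention for division and does not affect the limit superior.\<close>

definition lang_entropy :: "'a set \<Rightarrow> 'a list set \<Rightarrow> ereal" where
  "lang_entropy A L =
    limsup (\<lambda>n. ereal (1 / real n * log 2 (real (class_count A L (words_upto A n)))))"

lemma finite_words_upto: "finite A \<Longrightarrow> finite (words_upto A n)"
  using finite_lists_length_le[of A n]
  by (simp add: words_upto_def lists_eq_set)

lemma equiv_lang_rel: "equiv (lists A) (lang_rel A F L)"
  by (rule equivI) (auto simp: lang_rel_def refl_on_def sym_def trans_def)

lemma finite_lang_classes:
  assumes "finite F"
  shows "finite (lists A // lang_rel A F L)"
proof -
  have "lists A // lang_rel A F L
    \<subseteq> (\<lambda>S. {v \<in> lists A. {w \<in> F. v @ w \<in> L} = S}) ` Pow F"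
  proof
    fix C assume "C \<in> lists A // lang_rel A F L"
    then obtain u where u: "u \<in> lists A" "C = lang_rel A F L `` {u}"
      by (auto simp: quotient_def)
    have "C = {v \<in> lists A. {w \<in> F. v @ w \<in> L} = {w \<in> F. u @ w \<in> L}}"
      using u by (auto simp: lang_rel_def)
    then show "C \<in> (\<lambda>S. {v \<in> lists A. {w \<in> F. v @ w \<in> L} = S}) ` Pow F"
      by blast
  qed
  then show ?thesis
    using assms finite_subset by fastforce
qed

lemma lang_rel_antimono: "F \<subseteq> G \<Longrightarrow> lang_rel A G L \<subseteq> lang_rel A F L"
  by (auto simp: lang_rel_def)

lemma words_upto_mono: "m \<le> n \<Longrightarrow> words_upto A m \<subseteq> words_upto A n"
  by (auto simp: words_upto_def)


section \<open>Entropic dimension of a pseudo-metric space\<close>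

definition pseudo_metric_space :: "'x set \<Rightarrow> ('x \<Rightarrow> 'x \<Rightarrow> real) \<Rightarrow> bool" where
  "pseudo_metric_space X d \<longleftrightarrow>
    (\<forall>x\<in>X. \<forall>y\<in>X. 0 \<le> d x y \<and> d x y = d y x) \<and> (\<forall>x\<in>X. d x x = 0) \<and>
    (\<forall>x\<in>X. \<forall>y\<in>X. \<forall>z\<in>X. d x z \<le> d x y + d y z)"

definition pm_ball :: "'x set \<Rightarrow> ('x \<Rightarrow> 'x \<Rightarrow> real) \<Rightarrow> 'x \<Rightarrow> real \<Rightarrow> 'x set" where
  "pm_ball X d x r = {y \<in> X. d x y < r}"

definition ball_cover :: "'x set \<Rightarrow> ('x \<Rightarrow> 'x \<Rightarrow> real) \<Rightarrow> real \<Rightarrow> 'x set set \<Rightarrow> bool" where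
  "ball_cover X d r B \<longleftrightarrow> finite B \<and> B \<subseteq> (\<lambda>x. pm_ball X d x r) ` X \<and> \<Union> B = X"

definition pm_precompact :: "'x set \<Rightarrow> ('x \<Rightarrow> 'x \<Rightarrow> real) \<Rightarrow> bool" where
  "pm_precompact X d \<longleftrightarrow> (\<forall>r>0. \<exists>B. ball_cover X d r B)"

text \<open>The following two notions are only meaningful for precompact spaces; otherwise the
  \<open>LEAST\<close> operator may be applied to an empty predicate.\<close>

definition covering_number :: "'x set \<Rightarrow> ('x \<Rightarrow> 'x \<Rightarrow> real) \<Rightarrow> real \<Rightarrow> nat" where
  "covering_number X d r = (LEAST k. \<exists>B. ball_cover X d r B \<and> card B = k)"

definition entropic_dim :: "'x set \<Rightarrow> ('x \<Rightarrow> 'x \<Rightarrow> real) \<Rightarrow> ereal" where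
  "entropic_dim X d =
    Limsup (at_right 0) (\<lambda>r. ereal (log 2 (real (covering_number X d r)) / log 2 (1 / r)))"


section \<open>The pseudo-ultrametric of a descending sequence of equivalence relations\<close>

text \<open>The infimum is taken in the extended naturals, so that it is \<open>\<infinity>\<close> for the empty set.\<close>

definition seq_dist :: "(nat \<Rightarrow> ('x \<times> 'x) set) \<Rightarrow> 'x \<Rightarrow> 'x \<Rightarrow> real" where
  "seq_dist R x y =
    (case Inf (enat ` {n. (x, y) \<notin> R n}) of enat n \<Rightarrow> 2 powr (- real n) | \<infinity> \<Rightarrow> 0)"

lemma seq_dist_nonneg: "0 \<le> seq_dist R x y"
  by (simp add: seq_dist_def split: enat.split)

lemma seq_dist_less_iff:
  assumes "decseq R"
  shows "seq_dist R x y < 2 powr (- real n) \<longleftrightarrow> (x, y) \<in> R n"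
proof (cases "\<exists>m. (x, y) \<notin> R m")
  case False
  then show ?thesis by (simp add: seq_dist_def Inf_enat_def)
next
  case True
  define m where "m = (LEAST m. (x, y) \<notin> R m)"
  have m: "(x, y) \<notin> R m" "\<And>k. k < m \<Longrightarrow> (x, y) \<in> R k"
    using LeastI_ex[OF True] not_less_Least[where P = "\<lambda>m. (x, y) \<notin> R m"]
    unfolding m_def by blast+
  have "Inf (enat ` {n. (x, y) \<notin> R n}) = enat m"
    using m by (intro antisym Inf_lower Inf_greatest) (auto simp: not_less[symmetric])
  then have "seq_dist R x y = 2 powr (- real m)" by (simp add: seq_dist_def)
  moreover have "(x, y) \<in> R n \<longleftrightarrow> n < m"
    using m decseqD[OF assms, of m n] by (cases "n < m") auto
  ultimately show ?thesis
    using powr_less_cancel_iff[of "2::real" "- real m" "- real n"] by simp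
qed

lemma seq_dist_ultra:
  assumes "\<And>n. (x, y) \<in> R n \<Longrightarrow> (y, z) \<in> R n \<Longrightarrow> (x, z) \<in> R n"
  assumes "decseq R"
  shows "seq_dist R x z \<le> max (seq_dist R x y) (seq_dist R y z)"
proof (rule ccontr)
  assume *: "\<not> ?thesis"
  then have "seq_dist R x z \<noteq> 0"
    using seq_dist_nonneg[of R x y] by auto
  then obtain n where n: "seq_dist R x z = 2 powr (- real n)"
    by (auto simp: seq_dist_def split: enat.splits)
  then have "(x, z) \<in> R n"
    using * assms(1)[of n] by (simp add: seq_dist_less_iff[OF assms(2), symmetric] not_le)
  then show False
    using n seq_dist_less_iff[OF assms(2), of x z n] by simp
qed

lemma pseudo_metric_space_seq_dist:
  assumes "\<And>n. equiv X (R n)" "decseq R"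
  shows "pseudo_metric_space X (seq_dist R)"
proof -
  have sym: "(x, y) \<in> R n \<longleftrightarrow> (y, x) \<in> R n" for x y n
    using assms(1)[of n] by (auto simp: equiv_def sym_def)
  have "seq_dist R x x = 0" if "x \<in> X" for x
    using that assms(1) by (simp add: seq_dist_def Inf_enat_def equiv_def refl_on_def)
  moreover have "seq_dist R x y = seq_dist R y x" for x y
    unfolding seq_dist_def using sym[of x y] by simp
  moreover have "seq_dist R x z \<le> seq_dist R x y + seq_dist R y z" for x y z
  proof -
    have "seq_dist R x z \<le> max (seq_dist R x y) (seq_dist R y z)"
      using assms by (intro seq_dist_ultra) (auto simp: equiv_def dest: transD)
    then show ?thesis
      using seq_dist_nonneg[of R x y] seq_dist_nonneg[of R y z] by linarith
  qed
  ultimately show ?thesis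
    unfolding pseudo_metric_space_def by (intro conjI ballI seq_dist_nonneg)
qed

lemma pm_precompact_seq_dist:
  assumes eq: "\<And>n. equiv X (R n)" and dec: "decseq R" and fin: "\<And>n. finite (X // R n)"
  shows "pm_precompact X (seq_dist R)"
  unfolding pm_precompact_def
proof (intro allI impI)
  fix r :: real assume "r > 0"
  then obtain n :: nat where n: "(1 / 2) ^ n < r"
    using real_arch_pow_inv[of r "1/2"] by auto
  have pow: "2 powr (- real n) = (1 / 2) ^ n"
    by (simp add: powr_minus powr_realpow power_one_over inverse_eq_divide)
  define c where "c C = (SOME x. x \<in> C)" for C :: "'a set"
  define B where "B = (\<lambda>C. pm_ball X (seq_dist R) (c C) r) ` (X // R n)"
  have c: "c C \<in> C" if "C \<in> X // R n" for C
    using in_quotient_imp_non_empty[OF eq that] unfolding c_def by (auto intro: someI)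
  have cX: "c C \<in> X" if "C \<in> X // R n" for C
    using c[OF that] in_quotient_imp_subset[OF eq that] by auto
  have "X \<subseteq> \<Union> B"
  proof
    fix x assume x: "x \<in> X"
    define C where "C = R n `` {x}"
    have C: "C \<in> X // R n" using x by (auto simp: C_def quotient_def)
    have "(c C, x) \<in> R n"
      using c[OF C] eq[of n] by (auto simp: C_def equiv_def dest: symD)
    then have "seq_dist R (c C) x < (1 / 2) ^ n"
      by (simp add: seq_dist_less_iff[OF dec] flip: pow)
    then have "seq_dist R (c C) x < r" using n by simp
    then show "x \<in> \<Union> B" using x C by (auto simp: B_def pm_ball_def)
  qed
  moreover have "\<Union> B \<subseteq> X" by (auto simp: B_def pm_ball_def)
  moreover have "B \<subseteq> (\<lambda>x. pm_ball X (seq_dist R) x r) ` X" using cX by (auto simp: B_def)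
  moreover have "finite B" using fin by (simp add: B_def)
  ultimately show "\<exists>B. ball_cover X (seq_dist R) r B"
    unfolding ball_cover_def by blast
qed

lemma pseudo_metric_precompact_lang:
  assumes "finite A"
  shows "pseudo_metric_space (lists A) (seq_dist (\<lambda>n. lang_rel A (words_upto A n) L))"
    and "pm_precompact (lists A) (seq_dist (\<lambda>n. lang_rel A (words_upto A n) L))"
proof -
  have "decseq (\<lambda>n. lang_rel A (words_upto A n) L)"
    by (auto simp: decseq_def intro!: lang_rel_antimono words_upto_mono
        dest!: subsetD[OF lang_rel_antimono[OF words_upto_mono]])
  then show "pseudo_metric_space (lists A) (seq_dist (\<lambda>n. lang_rel A (words_upto A n) L))"
    and "pm_precompact (lists A) (seq_dist (\<lambda>n. lang_rel A (words_upto A n) L))"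
    using assms by (auto intro!: pseudo_metric_space_seq_dist pm_precompact_seq_dist
        equiv_lang_rel finite_lang_classes finite_words_upto)
qed

end

theory Submission
  imports Defs "HOL-Real_Asymp.Real_Asymp"
begin

text \<open>The distance takes only the values \<open>0\<close> and \<open>2 powr (- n)\<close>, so for
  \<open>2 powr (- n - 1) < r \<le> 2 powr (- n)\<close> the balls of radius \<open>r\<close> are exactly the classes of the
  \<open>n\<close>-th relation, and a cover of the space by classes must use all of them. Hence the quotient
  defining the dimension is at most the \<open>n\<close>-th term of the entropy sequence, with equality at
  \<open>r = 2 powr (- n)\<close>.\<close>

text \<open>The image of \<open>F\<close> under \<open>f\<close> is at least as fine as
  \<open>G\<close>, and refining a filter can only lower the limit superior. Both inequalities for
  the dimension are closed by such a reparametrization.\<close>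

lemma Limsup_filterlim_compose_le:
  fixes g :: "'b \<Rightarrow> 'c :: complete_linorder"
  assumes "filterlim f G F"
  shows "Limsup F (\<lambda>x. g (f x)) \<le> Limsup G g"
proof -
  have "Limsup F (\<lambda>x. g (f x)) \<le> Limsup (filtermap f F) g"
    by (rule Limsup_filtermap_ge)
  also have "\<dots> \<le> Limsup G g"
    using assms unfolding Limsup_def filterlim_def le_filter_def
    by (intro INF_superset_mono) auto
  finally show ?thesis .
qed

text \<open>A distance below \<open>2 powr (- n)\<close> is either 0 or \<open>2 powr (- m)\<close>
  with \<open>m \<ge> n + 1\<close>; in both cases it stays below \<open>r\<close>.\<close>

lemma seq_dist_less_iff_between:
  assumes "decseq R" and "2 powr (- real n - 1) < r" and "r \<le> 2 powr (- real n)"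
  shows "seq_dist R x y < r \<longleftrightarrow> (x, y) \<in> R n"
proof
  assume "seq_dist R x y < r"
  then show "(x, y) \<in> R n"
    using assms(3) by (simp add: seq_dist_less_iff[OF assms(1), symmetric])
next
  assume "(x, y) \<in> R n"
  then have less: "seq_dist R x y < 2 powr (- real n)"
    by (simp add: seq_dist_less_iff[OF assms(1)])
  show "seq_dist R x y < r"
  proof (cases "Inf (enat ` {n. (x, y) \<notin> R n})")
    case (enat m)
    then have d: "seq_dist R x y = 2 powr (- real m)"
      by (simp add: seq_dist_def)
    with less have "n < m" by simp
    then have "seq_dist R x y \<le> 2 powr (- real n - 1)"
      using d by simp
    with assms(2) show ?thesis by simp
  next
    case infinity
    then have "seq_dist R x y = 0" by (simp add: seq_dist_def)
    moreover have "0 < (2::real) powr (- real n - 1)" by simp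
    ultimately show ?thesis using assms(2) by linarith
  qed
qed

text \<open>Classes are nonempty and pairwise disjoint, so a point of \<open>C\<close> can only be
  covered by \<open>C\<close> itself.\<close>

lemma quotient_subcover_eq:
  assumes "equiv X r" "B \<subseteq> X // r" "\<Union> B = X"
  shows "B = X // r"
proof
  show "X // r \<subseteq> B"
  proof
    fix C assume C: "C \<in> X // r"
    then obtain x where "x \<in> C" "x \<in> X"
      using assms(1) in_quotient_imp_non_empty in_quotient_imp_subset by fastforce
    with assms(3) obtain D where "D \<in> B" "x \<in> D" by blast
    with quotient_disj[OF assms(1) C, of D] \<open>x \<in> C\<close> assms(2) show "C \<in> B" by blast
  qed
qed (fact assms(2))

lemma covering_number_seq_dist:
  assumes eq: "equiv X (R n)" and dec: "decseq R" and fin: "finite (X // R n)"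
    and r: "2 powr (- real n - 1) < r" "r \<le> 2 powr (- real n)"
  shows "covering_number X (seq_dist R) r = card (X // R n)"
proof -
  have "pm_ball X (seq_dist R) x r = R n `` {x}" for x
    using seq_dist_less_iff_between[OF dec r] equiv_type[OF eq]
    by (auto simp: pm_ball_def)
  then have "(\<lambda>x. pm_ball X (seq_dist R) x r) ` X = X // R n"
    by (auto simp: quotient_def)
  \<comment> \<open>There is exactly one ball cover, so the minimum in
    \<open>covering_number\<close> ranges over a single value.\<close>
  then have "ball_cover X (seq_dist R) r B \<longleftrightarrow> B = X // R n" for B
    using quotient_subcover_eq[OF eq, of B] fin Union_quotient[OF eq]
    by (auto simp: ball_cover_def)
  then show ?thesis
    by (auto simp: covering_number_def intro: Least_equality)
qed

lemma entropic_dim_seq_dist: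
  assumes eq: "\<And>n. equiv X (R n)" and dec: "decseq R" and fin: "\<And>n. finite (X // R n)"
    and "X \<noteq> {}"
  shows "entropic_dim X (seq_dist R) =
    limsup (\<lambda>n. ereal (1 / real n * log 2 (real (card (X // R n)))))"
    (is "_ = limsup ?b")
proof (rule antisym)
  let ?f = "\<lambda>r. ereal (log 2 (real (covering_number X (seq_dist R) r)) / log 2 (1 / r))"
  have ge1: "1 \<le> card (X // R n)" for n
    using fin[of n] \<open>X \<noteq> {}\<close> by (simp add: Suc_le_eq card_gt_0_iff quotient_is_empty)
  \<comment> \<open>For \<open>0 < r \<le> 1\<close> this is the unique \<open>n\<close> with
    \<open>2 powr (- n - 1) < r \<le> 2 powr (- n)\<close>.\<close>
  define N where "N r = nat \<lfloor>log 2 (1 / r)\<rfloor>" for r :: real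
  have N: "filterlim N sequentially (at_right 0)"
    unfolding N_def
    by (intro filterlim_compose[OF filterlim_nat_sequentially]
        filterlim_compose[OF filterlim_floor_sequentially]) real_asymp
  \<comment> \<open>The bound 1/2 forces \<open>N r \<ge> 1\<close>; at index 0 the term
    \<open>?b 0\<close> is 0 by the division convention and need not dominate.\<close>
  have le: "?f r \<le> ?b (N r)" if r: "0 < r" "r < 1/2" for r
  proof -
    define n where "n = N r"
    have l1: "1 \<le> log 2 (1 / r)"
      using r by (simp add: le_log_iff field_simps)
    then have n: "real n \<le> log 2 (1 / r)" "log 2 (1 / r) < real n + 1" "1 \<le> n"
      unfolding n_def N_def by linarith+
    have lr: "log 2 (1 / r) = - log 2 r" using r by (simp add: log_divide)
    have "2 powr (- real n - 1) < r" "r \<le> 2 powr (- real n)"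
      using n lr r by (simp_all add: less_log_iff[symmetric] log_le_iff[symmetric])
    then have "covering_number X (seq_dist R) r = card (X // R n)"
      by (intro covering_number_seq_dist assms)
    \<comment> \<open>The numerator is nonnegative by \<open>ge1\<close>, so replacing the
      denominator by the smaller \<open>n\<close> increases the quotient.\<close>
    moreover have "log 2 (card (X // R n)) / log 2 (1 / r) \<le> log 2 (card (X // R n)) / n"
      using n ge1[of n] by (intro divide_left_mono) auto
    ultimately show ?thesis by (simp add: n_def)
  qed
  have "entropic_dim X (seq_dist R) \<le> Limsup (at_right 0) (\<lambda>r. ?b (N r))"
    unfolding entropic_dim_def
    by (intro Limsup_mono eventually_mono[OF eventually_at_right_real[of 0 "1/2"]] le) auto
  also have "\<dots> \<le> limsup ?b"
    by (rule Limsup_filterlim_compose_le[OF N])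
  finally show "entropic_dim X (seq_dist R) \<le> limsup ?b" .

  \<comment> \<open>At this radius \<open>log 2 (1 / r)\<close> is exactly \<open>n\<close>. For
    \<open>n = 0\<close> both sides divide by 0 and are therefore 0.\<close>
  have "?b n = ?f (2 powr (- real n))" for n
    by (subst covering_number_seq_dist[where n = n])
       (simp_all add: eq dec fin log_divide)
  then have "limsup ?b = limsup (\<lambda>n. ?f (2 powr (- real n)))" by simp
  also have "\<dots> \<le> entropic_dim X (seq_dist R)"
    unfolding entropic_dim_def
    by (rule Limsup_filterlim_compose_le[where g = ?f]) real_asymp
  finally show "limsup ?b \<le> entropic_dim X (seq_dist R)" .
qed

theorem corollary5p2:
  fixes A :: "'a set" and L :: "'a list set"
    and Theta :: "nat \<Rightarrow> ('a list \<times> 'a list) set"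
  assumes "finite A"
    and "L \<subseteq> lists A"
    and "Theta = (\<lambda>n. lang_rel A (words_upto A n) L)"
  shows "entropic_dim (lists A) (seq_dist Theta) = lang_entropy A L"
proof -
  have "decseq Theta"
    unfolding assms(3) decseq_def by (intro allI impI lang_rel_antimono words_upto_mono)
  then show ?thesis
    unfolding lang_entropy_def class_count_def
    using assms(1,3)
    by (subst entropic_dim_seq_dist)
       (auto simp: equiv_lang_rel finite_lang_classes finite_words_upto)
qed

end
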